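(* Let $\sigma\ge 0$, let $N\in\{0,1,2,\dots\}\cup\{\infty\}$, let $\alpha_j\in\mathbb{R}\setminus\{0\}$ ($1\le j\le N$) with $\sum_{j=1}^N\alpha_j^{-2}<\infty$, and let $$g(z)=e^{-\sigma^2z}\prod_{j=1}^N\Big(1-\frac{z}{\alpha_j^2}\Big),\qquad G_g=\sigma^2\delta_0+\sum_{j=1}^N\frac{1}{\alpha_j^2}\delta_{1/\alpha_j^2}.$$ Let $n>-1$ be fixed and let $\{p_d\}_{d\ge1}$ be a sequence of monic polynomials with non-negative roots, $\deg p_d=d$, such that $m_1(p_d)/d\to\tau^2$ for some $\tau>0$ and $$d\,t\,d\mu_{\mathcal{D}_{d^{-2}}p_d}(t)\to dG_g(t)$$ weakly as Radon measures as $d\to\infty$. Then for every $\ell\in\mathbb{N}$, $$\lim_{d\to\infty}\frac{1}{(d)_{d-\ell}(n+d)_{d-\ell}}M_n^{d-\ell}p_d(x)=g(M_n)x^\ell$$ uniformly on compact subsets, where $M_n=xD^2+(n+1)D$ and $D=\frac{d}{dx}$.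
   Context: $(a)_k=a(a-1)\cdots(a-k+1)$ is the falling factorial. For a degree $d$ polynomial $p$ with real roots $y_1,\dots,y_d$, $\mu_p=\frac1d\sum_j\delta_{y_j}$ is the empirical root measure and $m_1(p)=\frac1d\sum_jy_j$. For $a>0$, $\mathcal{D}_ap(x)=a^dp(x/a)$ multiplies the roots of a degree $d$ polynomial by $a$. Weak convergence of finite measures means convergence of the integrals of bounded continuous functions. A power series $g(z)=\sum_kg_kz^k$ acts by $g(M_n)x^\ell=\sum_{k=0}^\ell g_kM_n^kx^\ell$. *)

theory Defs
  imports "HOL-Complex_Analysis.Complex_Analysis" "HOL-Library.Extended_Nat"
begin

definition falling_factorial :: "real \<Rightarrow> nat \<Rightarrow> real" where
  "falling_factorial a k = (\<Prod>i<k. a - real i)"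

text \<open>All complex roots are real and non-negative: the real roots, counted with multiplicity,
  exhaust the degree.\<close>
definition nonneg_rooted :: "real poly \<Rightarrow> bool" where
  "nonneg_rooted p \<longleftrightarrow> size (proots p) = degree p \<and> (\<forall>y\<in>#proots p. 0 \<le> y)"

definition root_mean :: "real poly \<Rightarrow> real" where
  "root_mean p = (\<Sum>\<^sub># (proots p)) / real (degree p)"

definition dilation :: "real \<Rightarrow> real poly \<Rightarrow> real poly" where
  "dilation a p = smult (a ^ degree p) (pcompose p [:0, 1 / a:])"

text \<open>The Borel measure $\sum_{i \in I} w_i \delta_{x_i}$ on the real line, for weights
  $w_i \ge 0$.\<close>
definition dirac_sum :: "'i set \<Rightarrow> ('i \<Rightarrow> real) \<Rightarrow> ('i \<Rightarrow> real) \<Rightarrow> real measure" where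
  "dirac_sum I w x = distr (density (count_space I) (\<lambda>i. ennreal (w i))) borel x"

text \<open>Each distinct root carries its multiplicity divided by the degree.\<close>
definition empirical_root_measure :: "real poly \<Rightarrow> real measure" where
  "empirical_root_measure p =
     dirac_sum (set_mset (proots p)) (\<lambda>y. real (count (proots p) y) / real (degree p)) (\<lambda>y. y)"

definition converges_weakly :: "(nat \<Rightarrow> real measure) \<Rightarrow> real measure \<Rightarrow> bool" where
  "converges_weakly \<mu> \<nu> \<longleftrightarrow>
     (\<forall>f :: real \<Rightarrow> real. continuous_on UNIV f \<and> bounded (range f) \<longrightarrow>
        (\<lambda>d. \<integral>t. f t \<partial>\<mu> d) \<longlonglongrightarrow> (\<integral>t. f t \<partial>\<nu>))"

text \<open>The operator $M_n = x D^2 + (n+1) D$ on real or complex polynomials.\<close>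
definition M_op :: "real \<Rightarrow> 'a::real_field poly \<Rightarrow> 'a poly" where
  "M_op n p = [:0, 1:] * pderiv (pderiv p) + smult (of_real (n + 1)) (pderiv p)"

text \<open>The polynomial $F(M_n) x^l$ for a power series $F$; higher terms vanish because
  $M_n$ lowers the degree.\<close>
definition fps_M_op_monom :: "complex fps \<Rightarrow> real \<Rightarrow> nat \<Rightarrow> complex poly" where
  "fps_M_op_monom F n l = (\<Sum>k\<le>l. smult (fps_nth F k) ((M_op n ^^ k) (monom 1 l)))"

text \<open>The index set $\{j \ge 1 : j \le N\}$, which is infinite for $N = \infty$.\<close>
definition index_upto :: "enat \<Rightarrow> nat set" where
  "index_upto N = {j. 1 \<le> j \<and> enat j \<le> N}"

text \<open>For finite \<open>N\<close> all but finitely many factors are 1, so this is the finite product.\<close>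
definition g_fun :: "real \<Rightarrow> enat \<Rightarrow> (nat \<Rightarrow> real) \<Rightarrow> complex \<Rightarrow> complex" where
  "g_fun \<sigma> N \<alpha> z = exp (- of_real (\<sigma>^2) * z) *
     prodinf (\<lambda>j. if j \<in> index_upto N then 1 - z / of_real ((\<alpha> j)^2) else 1)"

text \<open>Index \<open>0\<close>, which is not in \<^term>\<open>index_upto N\<close>, is used for the atom at the origin.\<close>
definition G_measure :: "real \<Rightarrow> enat \<Rightarrow> (nat \<Rightarrow> real) \<Rightarrow> real measure" where
  "G_measure \<sigma> N \<alpha> = dirac_sum (insert 0 (index_upto N))
     (\<lambda>j. if j = 0 then \<sigma>^2 else 1 / (\<alpha> j)^2)
     (\<lambda>j. if j = 0 then 0 else 1 / (\<alpha> j)^2)"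

end

theory Submission
  imports Defs
begin

text \<open>
  The operator \<open>M_n\<close> maps \<open>x^k\<close> to \<open>k (k + n) x^(k-1)\<close>, so it acts on coefficients one at a
  time: apart from a factor made of falling factorials, the coefficient of \<open>x^(l-j)\<close> in
  \<open>M_n^(d-l) p\<^sub>d\<close> is the coefficient of \<open>x^(d-j)\<close> in \<open>p\<^sub>d\<close>, that is \<open>(-1)^j e\<^sub>j(y)\<close> for the roots
  \<open>y\<close> of \<open>p\<^sub>d\<close>.  After the normalisation the factor becomes
  \<open>(l)\<^sub>j (n+l)\<^sub>j / ((d)\<^sub>j (n+d)\<^sub>j)\<close>.  Its numerator is the factor that \<open>M_n^j x^l\<close> produces in the
  limit polynomial, and its denominator grows like \<open>d^(2 j)\<close>, which turns \<open>e\<^sub>j(y)\<close> into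
  \<open>e\<^sub>j(y/d\<^sup>2)\<close>.  The polynomials in question have degree at most \<open>l\<close>, so uniform convergence on
  compact sets is convergence of the coefficients, and the claim reduces to
  \<open>(-1)^j e\<^sub>j(y/d\<^sup>2) \<longlonglongrightarrow> g\<^sub>j\<close> for each \<open>j\<close>.

  Both sides are determined by power sums.  If \<open>F(0) = 1\<close> and \<open>- F'/F = \<Sum>\<^sub>i P\<^sub>i z^i\<close>, then Newton's
  recurrence computes the coefficients of \<open>F\<close> from the sequence \<open>P\<close>, and each coefficient depends
  continuously on finitely many terms of \<open>P\<close>.  For \<open>F = \<Prod>(1 - (y/d\<^sup>2) z)\<close> the number \<open>P\<^sub>i\<close> is the
  power sum \<open>\<Sum>(y/d\<^sup>2)^(i+1)\<close>; for \<open>F = g\<close> it is \<open>\<Sum>\<^sub>j \<alpha>\<^sub>j^(-2(i+1))\<close>, increased by \<open>\<sigma>\<^sup>2\<close> when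
  \<open>i = 0\<close>.  These are the \<open>i\<close>-th moments of \<open>d t d\<mu>\<close> and of \<open>G\<^sub>g\<close>: the density \<open>t\<close> raises the exponent
  by one, and the atom of \<open>G\<^sub>g\<close> at the origin is what the zeroth moment sees and the others do not.
  So it remains to pass from weak convergence to convergence of moments.  Testing with the constant
  function \<open>1\<close> bounds the sum of the non-negative scaled roots, hence every scaled root, and so
  \<open>t^i\<close> may be truncated to a bounded continuous function without changing its integrals.

  The lemmas that carry the argument are \<open>has_power_sums_imp_nth\<close> and \<open>tendsto_newton_coeff\<close>
  (recurrence and continuity), \<open>weak_convergence_imp_power_sums\<close>, \<open>exp_prod_coeff_eq_newton\<close> (the
  coefficients of \<open>g\<close>) and \<open>normalized_M_op_coeff_tendsto\<close>.
\<close>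

section \<open>Newton's recurrence for power series\<close>

text \<open>The condition on the derivative is \<open>- F'/F = \<Sum>\<^sub>i P\<^sub>i z^i\<close>.  The index is shifted: for
  \<open>F = \<Prod>(1 - a z)\<close> the number \<open>P\<^sub>i\<close> is the power sum of the \<open>(i+1)\<close>-st powers of the \<open>a\<close>, which
  is the \<open>i\<close>-th moment of the measure \<open>\<Sum> a \<delta>\<^sub>a\<close>.\<close>
definition has_power_sums :: "'a::field_char_0 fps \<Rightarrow> (nat \<Rightarrow> 'a) \<Rightarrow> bool" where
  "has_power_sums F P \<longleftrightarrow> fps_nth F 0 = 1 \<and> fps_deriv F = - (Abs_fps P * F)"

text \<open>Newton's identities, solved for the coefficients: with \<open>P\<close> as above these are the numbers
  \<open>(-1)^k e\<^sub>k\<close>.\<close>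
fun newton_coeff :: "(nat \<Rightarrow> 'a::field_char_0) \<Rightarrow> nat \<Rightarrow> 'a" where
  "newton_coeff P 0 = 1"
| "newton_coeff P (Suc k) = - (\<Sum>i\<le>k. P i * newton_coeff P (k - i)) / of_nat (Suc k)"

lemma has_power_sums_imp_nth:
  assumes "has_power_sums F P"
  shows "fps_nth F k = newton_coeff P k"
proof (induction k rule: less_induct)
  case (less k)
  show ?case
  proof (cases k)
    case 0
    then show ?thesis using assms by (simp add: has_power_sums_def)
  next
    case (Suc m)
    have "of_nat (Suc m) * fps_nth F (Suc m) = fps_nth (fps_deriv F) m"
      by simp
    also have "\<dots> = - (\<Sum>i\<le>m. P i * fps_nth F (m - i))"
      using assms by (simp add: has_power_sums_def fps_mult_nth atLeast0AtMost)
    also have "(\<Sum>i\<le>m. P i * fps_nth F (m - i)) = (\<Sum>i\<le>m. P i * newton_coeff P (m - i))"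
      by (intro sum.cong refl) (use less Suc in simp)
    finally have "of_nat (Suc m) * fps_nth F (Suc m) = - (\<Sum>i\<le>m. P i * newton_coeff P (m - i))" .
    then have "fps_nth F (Suc m) = - (\<Sum>i\<le>m. P i * newton_coeff P (m - i)) / of_nat (Suc m)"
      by (metis nonzero_mult_div_cancel_left of_nat_neq_0)
    then show ?thesis using Suc by simp
  qed
qed

lemma has_power_sums_1: "has_power_sums 1 (\<lambda>_. 0)"
  by (auto simp: has_power_sums_def fps_eq_iff fps_mult_nth)

text \<open>A logarithmic derivative turns products into sums; this is why power sums are easy to
  compute for \<open>g\<close> and for the polynomials alike.\<close>
lemma has_power_sums_mult:
  assumes "has_power_sums F P" "has_power_sums G Q"
  shows "has_power_sums (F * G) (\<lambda>i. P i + Q i)"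
proof -
  have "Abs_fps (\<lambda>i. P i + Q i) = Abs_fps P + Abs_fps Q"
    by (simp add: fps_eq_iff)
  then show ?thesis
    using assms by (simp add: has_power_sums_def algebra_simps)
qed

lemma has_power_sums_prod:
  assumes "\<And>j. j \<in> A \<Longrightarrow> has_power_sums (F j) (P j)"
  shows "has_power_sums (\<Prod>j\<in>A. F j) (\<lambda>i. \<Sum>j\<in>A. P j i)"
  using assms
  by (induction A rule: infinite_finite_induct) (auto intro: has_power_sums_1 has_power_sums_mult)

lemma has_power_sums_prod_mset:
  assumes "\<And>y. has_power_sums (F y) (P y)"
  shows "has_power_sums (\<Prod>y\<in>#A. F y) (\<lambda>i. \<Sum>y\<in>#A. P y i)"
  by (induction A) (auto intro: has_power_sums_1 has_power_sums_mult assms)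

text \<open>The geometric series \<open>a / (1 - a z)\<close>.\<close>
lemma has_power_sums_linear: "has_power_sums (1 - fps_const a * fps_X) (\<lambda>i. a ^ Suc i)"
proof -
  have "Abs_fps (\<lambda>i. a ^ Suc i) * (1 - fps_const a * fps_X) = fps_const a"
  proof (rule fps_ext)
    fix m
    have "Abs_fps (\<lambda>i. a ^ Suc i) * (1 - fps_const a * fps_X)
      = Abs_fps (\<lambda>i. a ^ Suc i) - fps_const a * (fps_X * Abs_fps (\<lambda>i. a ^ Suc i))"
      by (simp add: algebra_simps)
    then show "fps_nth (Abs_fps (\<lambda>i. a ^ Suc i) * (1 - fps_const a * fps_X)) m = fps_nth (fps_const a) m"
      by (cases m) (simp_all add: fps_X_mult_nth)
  qed
  then show ?thesis
    by (simp add: has_power_sums_def)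
qed

lemma has_power_sums_exp: "has_power_sums (fps_exp (- c)) (\<lambda>i. if i = 0 then c else 0)"
proof -
  have "Abs_fps (\<lambda>i. if i = 0 then c else 0) = fps_const c"
    by (simp add: fps_eq_iff)
  then show ?thesis
    by (simp add: has_power_sums_def fps_const_neg[symmetric] del: fps_const_neg)
qed

text \<open>The coefficient of order \<open>k\<close> is homogeneous of degree \<open>k\<close> in the roots; for roots divided by
  \<open>d\<^sup>2\<close> this produces the factor \<open>d^(-2 k)\<close>.\<close>
lemma newton_coeff_scale:
  "newton_coeff (\<lambda>i. c ^ Suc i * P i) k = c ^ k * newton_coeff P k"
proof (induction k rule: less_induct)
  case (less k)
  show ?case
  proof (cases k)
    case 0
    then show ?thesis by simp
  next
    case (Suc m)
    have "(\<Sum>i\<le>m. c ^ Suc i * P i * newton_coeff (\<lambda>i. c ^ Suc i * P i) (m - i))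
        = (\<Sum>i\<le>m. c ^ Suc m * (P i * newton_coeff P (m - i)))"
    proof (intro sum.cong refl)
      fix i assume "i \<in> {..m}"
      then have IH: "newton_coeff (\<lambda>i. c ^ Suc i * P i) (m - i) = c ^ (m - i) * newton_coeff P (m - i)"
        and pow: "c ^ Suc m = c ^ Suc i * c ^ (m - i)"
        using less[of "m - i"] Suc by (auto simp flip: power_add)
      then show "c ^ Suc i * P i * newton_coeff (\<lambda>i. c ^ Suc i * P i) (m - i)
          = c ^ Suc m * (P i * newton_coeff P (m - i))"
        unfolding IH pow by (simp only: mult_ac)
    qed
    then show ?thesis
      using Suc by (simp add: sum_distrib_left del: power_Suc)
  qed
qed

lemma newton_coeff_of_real:
  "newton_coeff (\<lambda>i. of_real (P i)) k = (of_real (newton_coeff P k) :: complex)"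
proof (induction k rule: less_induct)
  case (less k)
  show ?case
  proof (cases k)
    case (Suc m)
    have "(\<Sum>i\<le>m. complex_of_real (P i) * newton_coeff (\<lambda>i. of_real (P i)) (m - i))
        = (\<Sum>i\<le>m. of_real (P i) * of_real (newton_coeff P (m - i)))"
      by (intro sum.cong refl arg_cong2[where f = "(*)"] less) (use Suc in auto)
    then show ?thesis
      using Suc by simp
  qed simp
qed

text \<open>Each coefficient is a polynomial in finitely many power sums.  The lemma serves twice: for
  the scaled roots as \<open>d \<longlonglongrightarrow> \<infinity>\<close>, and for the partial products of \<open>g\<close>.\<close>
lemma tendsto_newton_coeff:
  fixes P :: "'b \<Rightarrow> nat \<Rightarrow> 'a::real_normed_field"
  assumes "\<And>i. ((\<lambda>d. P d i) \<longlongrightarrow> Q i) \<F>"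
  shows "((\<lambda>d. newton_coeff (P d) k) \<longlongrightarrow> newton_coeff Q k) \<F>"
proof (induction k rule: less_induct)
  case (less k)
  show ?case
  proof (cases k)
    case (Suc m)
    show ?thesis
      unfolding Suc newton_coeff.simps
      by (intro tendsto_divide tendsto_minus tendsto_sum tendsto_mult tendsto_const assms less)
         (use Suc in \<open>auto simp del: of_nat_Suc\<close>)
  qed simp
qed

section \<open>Monic polynomials whose roots exhaust the degree\<close>

lemma monic_eq_prod_proots:
  fixes p :: "'a::idom poly"
  assumes "lead_coeff p = 1" "size (proots p) = degree p"
  shows "p = (\<Prod>y\<in>#proots p. [:- y, 1:])"
  using assms
proof (induction "degree p" arbitrary: p)
  case 0
  then have "p = 1" using degree_0_id[of p] by (simp add: one_pCons)
  then show ?case by simp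
next
  case (Suc m)
  from Suc.hyps Suc.prems have "proots p \<noteq> {#}" by auto
  then obtain y where "y \<in># proots p" by blast
  moreover have p0: "p \<noteq> 0" using Suc.prems by auto
  ultimately have "[:- y, 1:] dvd p"
    by (simp add: poly_eq_0_iff_dvd)
  then obtain q where q: "p = [:- y, 1:] * q" by (auto elim: dvdE)
  have q0: "q \<noteq> 0" using p0 q by auto
  have pr: "proots p = {#y#} + proots q"
    unfolding q by (subst proots_mult) (use q0 in \<open>auto\<close>)
  have deg: "degree p = Suc (degree q)"
    unfolding q using q0 by (subst degree_mult_eq) auto
  have "lead_coeff q = 1"
    using Suc.prems(1) unfolding q lead_coeff_mult by simp
  then have "q = (\<Prod>y\<in>#proots q. [:- y, 1:])"
    using Suc pr deg by (intro Suc.hyps) auto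
  then show ?case
    using pr q by simp
qed

text \<open>Reversing the order of the coefficients turns \<open>\<Prod>(x - y)\<close> into \<open>\<Prod>(1 - y x)\<close>, to which the
  recurrence applies.\<close>
lemma coeff_from_top_eq_newton:
  fixes p :: "'a::field_char_0 poly"
  assumes "lead_coeff p = 1" "size (proots p) = degree p" "j \<le> degree p"
  shows "coeff p (degree p - j) = newton_coeff (\<lambda>i. \<Sum>y\<in>#proots p. y ^ Suc i) j"
proof -
  have eq: "fps_of_poly (reflect_poly (\<Prod>y\<in>#A. [:- y, 1:])) = (\<Prod>y\<in>#A. 1 - fps_const y * fps_X)" for A :: "'a multiset"
  proof (induction A)
    case (add y A)
    have "fps_of_poly (reflect_poly [:- y, 1:]) = 1 - fps_const y * fps_X"
      by (auto simp: reflect_poly_pCons' fps_of_poly_pCons fps_const_neg[symmetric] monom_altdef simp del: fps_const_neg split: if_splits)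
    with add show ?case
      by (simp only: image_mset_add_mset prod_mset.add_mset reflect_poly_mult fps_of_poly_mult)
  qed simp
  have "has_power_sums (fps_of_poly (reflect_poly p)) (\<lambda>i. \<Sum>y\<in>#proots p. y ^ Suc i)"
    by (subst monic_eq_prod_proots[OF assms(1,2)], subst eq)
       (intro has_power_sums_prod_mset has_power_sums_linear)
  from has_power_sums_imp_nth[OF this, of j] show ?thesis
    using assms(3) by (simp add: coeff_reflect_poly)
qed

lemma proots_prod_linear: "proots (\<Prod>y\<in>#A. [:- y, 1::'a::idom:]) = A"
proof (induction A)
  case (add y A)
  have "(\<Prod>y\<in>#A. [:- y, 1::'a:]) \<noteq> 0"
    by (auto simp: prod_mset_zero_iff)
  then show ?case
    unfolding image_mset_add_mset prod_mset.add_mset by (subst proots_mult) (use add in auto)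
qed simp

lemma monic_dilation:
  assumes a: "a \<noteq> 0" and p: "lead_coeff p = 1" "size (proots p) = degree p"
  shows "proots (dilation a p) = image_mset (\<lambda>y. a * y) (proots p)"
    and "degree (dilation a p) = degree p"
proof -
  have eq: "smult (a ^ size A) (pcompose (\<Prod>y\<in>#A. [:- y, 1:]) [:0, 1 / a:])
      = (\<Prod>y\<in>#image_mset (\<lambda>y. a * y) A. [:- y, 1:])" for A
  proof (induction A)
    case (add y A)
    have "smult a (pcompose [:- y, 1:] [:0, 1 / a:]) = [:- (a * y), 1:]"
      using a by (simp add: pcompose_pCons)
    moreover have "smult (a ^ size (add_mset y A)) (pcompose (\<Prod>y\<in>#add_mset y A. [:- y, 1:]) [:0, 1 / a:])
      = smult a (pcompose [:- y, 1:] [:0, 1 / a:]) * smult (a ^ size A) (pcompose (\<Prod>y\<in>#A. [:- y, 1:]) [:0, 1 / a:])"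
      by (simp only: image_mset_add_mset prod_mset.add_mset pcompose_mult size_add_mset power_Suc
          mult_smult_left mult_smult_right smult_smult mult.commute)
    ultimately show ?case
      using add by simp
  qed (simp add: pcompose_1)
  have d: "dilation a p = (\<Prod>y\<in>#image_mset (\<lambda>y. a * y) (proots p). [:- y, 1:])"
    using eq[of "proots p"] p(2) monic_eq_prod_proots[OF p] by (simp add: dilation_def)
  show "proots (dilation a p) = image_mset (\<lambda>y. a * y) (proots p)"
    unfolding d by (rule proots_prod_linear)
  show "degree (dilation a p) = degree p"
    using a by (simp add: dilation_def degree_pcompose)
qed

section \<open>The action of \<open>M_n\<close> on coefficients\<close>

lemma coeff_M_op: "coeff (M_op n p) i = of_nat (Suc i) * of_real (n + real (Suc i)) * coeff p (Suc i)"
  by (cases i) (simp_all add: M_op_def coeff_pderiv coeff_pCons algebra_simps)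

lemma falling_factorial_Suc_left:
  "falling_factorial (a + 1) (Suc k) = (a + 1) * falling_factorial a k"
  unfolding falling_factorial_def by (subst prod.lessThan_Suc_shift) (simp add: algebra_simps)

lemma coeff_M_op_funpow:
  "coeff ((M_op n ^^ m) p) i =
     of_real (falling_factorial (real (i + m)) m * falling_factorial (n + real (i + m)) m) * coeff p (i + m)"
proof (induction m arbitrary: p)
  case 0
  then show ?case by (simp add: falling_factorial_def)
next
  case (Suc m)
  have "falling_factorial (real (i + Suc m)) (Suc m) = real (i + Suc m) * falling_factorial (real (i + m)) m"
    using falling_factorial_Suc_left[of "real (i + m)" m] by (simp add: algebra_simps)
  moreover have "falling_factorial (n + real (i + Suc m)) (Suc m) = (n + real (i + Suc m)) * falling_factorial (n + real (i + m)) m"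
    using falling_factorial_Suc_left[of "n + real (i + m)" m] by (simp add: algebra_simps)
  ultimately show ?case
    unfolding funpow_Suc_right o_apply Suc coeff_M_op by (simp add: mult_ac)
qed

lemma falling_factorial_add:
  "falling_factorial a (j + m) = falling_factorial a j * falling_factorial (a - real j) m"
proof (induction m)
  case (Suc m)
  then show ?case by (simp add: falling_factorial_def algebra_simps)
qed (simp add: falling_factorial_def)

lemma falling_factorial_pos: "a > real k - 1 \<Longrightarrow> falling_factorial a k > 0"
  unfolding falling_factorial_def by (intro prod_pos) auto

lemma tendsto_falling_factorial_over_power:
  "(\<lambda>d. falling_factorial (c + real d) j / real d ^ j) \<longlonglongrightarrow> 1"
proof -
  have "(\<lambda>d. \<Prod>i<j. (c + real d - real i) / real d) \<longlonglongrightarrow> (\<Prod>i<j. 1)"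
  proof (intro tendsto_prod)
    fix i
    have "(\<lambda>d. (c - real i) / real d) \<longlonglongrightarrow> 0"
      by (intro tendsto_divide_0[OF tendsto_const] filterlim_at_top_imp_at_infinity filterlim_real_sequentially)
    then have "(\<lambda>d. 1 + (c - real i) / real d) \<longlonglongrightarrow> 1 + 0"
      by (intro tendsto_add tendsto_const)
    moreover have "eventually (\<lambda>d. 1 + (c - real i) / real d = (c + real d - real i) / real d) sequentially"
      using eventually_gt_at_top[of 0] by eventually_elim (simp add: field_simps)
    ultimately show "(\<lambda>d. (c + real d - real i) / real d) \<longlonglongrightarrow> 1"
      by (simp add: filterlim_cong)
  qed
  then show ?thesis
    by (simp add: falling_factorial_def prod_dividef)
qed

text \<open>The falling factorial of \<open>c + d\<close> with \<open>d - l + j\<close> factors can be split after the first \<open>j\<close> factors or before the last \<open>j\<close> factors.  A ratio of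
  two products with \<open>d - l\<close> factors thereby becomes a ratio of products whose length is fixed as
  \<open>d\<close> grows.  The bound on \<open>c\<close> keeps all factors of the denominators positive.\<close>
lemma falling_factorial_ratio:
  assumes "j \<le> l" "l \<le> d" "c > -1"
  shows "falling_factorial (c + real d - real j) (d - l) / falling_factorial (c + real d) (d - l)
    = falling_factorial (c + real l) j / falling_factorial (c + real d) j"
proof -
  have "falling_factorial (c + real d) j * falling_factorial (c + real d - real j) (d - l)
     = falling_factorial (c + real d) (d - l) * falling_factorial (c + real l) j"
    using falling_factorial_add[of "c + real d" j "d - l"] falling_factorial_add[of "c + real d" "d - l" j] assms
    by (simp add: add.commute of_nat_diff)
  moreover have "falling_factorial (c + real d) j > 0" "falling_factorial (c + real d) (d - l) > 0"
    using assms by (auto intro!: falling_factorial_pos simp: of_nat_diff)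
  ultimately show ?thesis
    by (simp add: field_simps)
qed

section \<open>Integrals against the measures\<close>

lemma integral_dirac_sum:
  assumes "\<And>i. i \<in> I \<Longrightarrow> 0 \<le> w i" "f \<in> borel_measurable borel"
  shows "(\<integral>t. f t \<partial>dirac_sum I w x) = (\<integral>i. w i * f (x i) \<partial>count_space I)"
  unfolding dirac_sum_def
  by (subst integral_distr, simp, use assms in simp, subst integral_density)
     (use assms in \<open>auto simp: AE_count_space\<close>)

lemma sum_mset_eq_sum_count:
  fixes f :: "'a \<Rightarrow> 'b::comm_semiring_1"
  shows "(\<Sum>y\<in>#A. f y) = (\<Sum>y\<in>set_mset A. of_nat (count A y) * f y)"
proof (induction A)
  case (add x A)
  have "(\<Sum>y\<in>set_mset (add_mset x A). of_nat (count (add_mset x A) y) * f y)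
     = (\<Sum>y\<in>insert x (set_mset A). of_nat (count A y) * f y + (if y = x then f x else 0))"
    by (intro sum.cong) (auto simp: algebra_simps)
  also have "\<dots> = (\<Sum>y\<in>insert x (set_mset A). of_nat (count A y) * f y) + f x"
    by (subst sum.distrib) (simp add: sum.delta)
  also have "(\<Sum>y\<in>insert x (set_mset A). of_nat (count A y) * f y) = (\<Sum>y\<in>set_mset A. of_nat (count A y) * f y)"
    by (intro sum.mono_neutral_right) (auto simp: not_in_iff)
  finally show ?case
    using add by (simp add: add.commute)
qed simp

lemma integral_weighted_empirical_root_measure:
  assumes "degree q > 0" "\<And>y. y \<in># proots q \<Longrightarrow> 0 \<le> y" "f \<in> borel_measurable borel"
  shows "(\<integral>t. f t \<partial>density (empirical_root_measure q) (\<lambda>t. ennreal (real (degree q) * t)))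
    = (\<Sum>y\<in>#proots q. y * f y)"
proof -
  let ?c = "real (degree q)"
  have sets: "sets (empirical_root_measure q) = sets borel"
    by (simp add: empirical_root_measure_def dirac_sum_def)
  \<comment> \<open>A density that is non-negative everywhere, not only on the support, avoids an AE argument.\<close>
  have "(\<lambda>t. ennreal (?c * t)) = (\<lambda>t. ennreal (max 0 (?c * t)))"
    by (simp add: ennreal_neg max_def fun_eq_iff)
  then have "(\<integral>t. f t \<partial>density (empirical_root_measure q) (\<lambda>t. ennreal (?c * t)))
     = (\<integral>t. max 0 (?c * t) * f t \<partial>empirical_root_measure q)"
    by (simp only:, subst integral_density)
       (use assms in \<open>auto simp: measurable_cong_sets[OF sets refl]\<close>)
  also have "\<dots> = (\<integral>y. real (count (proots q) y) / ?c * (max 0 (?c * y) * f y) \<partial>count_space (set_mset (proots q)))"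
    unfolding empirical_root_measure_def by (rule integral_dirac_sum) (use assms in auto)
  also have "\<dots> = (\<Sum>y\<in>set_mset (proots q). real (count (proots q) y) / ?c * (max 0 (?c * y) * f y))"
    by (rule lebesgue_integral_count_space_finite) simp
  also have "\<dots> = (\<Sum>y\<in>set_mset (proots q). real (count (proots q) y) * (y * f y))"
    by (intro sum.cong refl) (use assms in \<open>auto simp: max_def field_simps mult_le_0_iff\<close>)
  also have "\<dots> = (\<Sum>y\<in>#proots q. y * f y)"
    by (simp add: sum_mset_eq_sum_count)
  finally show ?thesis .
qed

text \<open>Filling up the atoms with weights \<open>a\<^sub>j = 0\<close> outside the index set makes the integral a series
  over all natural numbers, so that finite and infinite \<open>N\<close> are treated together.\<close>
lemma integral_G_measure:
  assumes f: "f \<in> borel_measurable borel" "\<And>t. \<bar>f t\<bar> \<le> C"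
    and a: "a = (\<lambda>j. if j \<in> index_upto N then 1 / (\<alpha> j)^2 else 0)" "summable a"
  shows "(\<integral>t. f t \<partial>G_measure \<sigma> N \<alpha>) = \<sigma>^2 * f 0 + (\<Sum>j. a j * f (a j))"
proof -
  let ?I = "insert 0 (index_upto N)"
  define h where "h j = (if j = 0 then \<sigma>^2 else 1 / (\<alpha> j)^2) * f (if j = 0 then 0 else 1 / (\<alpha> j)^2)" for j
  have z: "0 \<notin> index_upto N" by (simp add: index_upto_def)
  have h: "indicator ?I j *\<^sub>R h j = (if j = 0 then \<sigma>^2 * f 0 else 0) + a j * f (a j)" for j
    using z by (auto simp: h_def a indicator_def)
  have "\<And>j. 0 \<le> a j" by (simp add: a)
  then have "summable (\<lambda>j. norm (a j * f (a j)))"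
    by (intro summable_comparison_test'[OF summable_mult2[OF a(2), of C]])
       (auto simp: abs_mult intro!: mult_left_mono f)
  \<comment> \<open>The two series differ only in the term with index \<open>0\<close>, so they are compared after a shift.\<close>
  then have sn: "summable (\<lambda>j. norm (indicator ?I j *\<^sub>R h j))"
    by (subst summable_Suc_iff[symmetric], simp only: h, subst (asm) summable_Suc_iff[symmetric]) simp
  have "(\<integral>t. f t \<partial>G_measure \<sigma> N \<alpha>) = (\<integral>j. h j \<partial>count_space ?I)"
    unfolding G_measure_def h_def by (rule integral_dirac_sum) (use f in auto)
  also have "\<dots> = (\<integral>j. h j \<partial>restrict_space (count_space UNIV) ?I)"
    by (simp add: restrict_count_space)
  also have "\<dots> = (\<integral>j. indicator ?I j *\<^sub>R h j \<partial>count_space UNIV)"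
    by (subst integral_restrict_space) auto
  also have "\<dots> = (\<Sum>j. indicator ?I j *\<^sub>R h j)"
    by (intro integral_count_space_nat) (use sn in \<open>simp add: integrable_count_space_nat_iff\<close>)
  also have "\<dots> = \<sigma>^2 * f 0 + (\<Sum>j. a j * f (a j))"
    unfolding h
    using sums_add[OF sums_single[of 0 "\<lambda>_. \<sigma>^2 * f 0"] summable_sums[OF summable_norm_cancel[OF \<open>summable (\<lambda>j. norm (a j * f (a j)))\<close>]]]
    by (simp add: sums_iff)
  finally show ?thesis .
qed

section \<open>The coefficients of \<open>g\<close>\<close>

lemma summable_power_of_summable:
  fixes a :: "nat \<Rightarrow> real"
  assumes "\<And>j. 0 \<le> a j" "summable a"
  shows "summable (\<lambda>j. a j ^ Suc i)"
proof (rule summable_comparison_test')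
  show "summable (\<lambda>j. suminf a ^ i * a j)"
    by (intro summable_mult assms)
  fix j
  have "a j \<le> suminf a"
    using sum_le_suminf[OF assms(2), of "{j}"] assms(1) by auto
  then have "a j ^ i \<le> suminf a ^ i"
    by (intro power_mono assms)
  then show "norm (a j ^ Suc i) \<le> suminf a ^ i * a j"
    using assms(1)[of j] by (simp add: abs_mult power_abs mult.commute[of "a j"] mult_right_mono)
qed

text \<open>For the partial products of \<open>g\<close> the recurrence applies to an explicit power series.  They
  converge uniformly on the unit disc, since \<open>\<Sum> a\<^sub>j < \<infinity>\<close>, so their Taylor coefficients converge to
  those of \<open>g\<close>; their power sums are the partial sums of the series on the right.  The factors may
  have zeros inside the disc, which the infinite product tolerates.\<close>
lemma exp_prod_coeff_eq_newton:
  fixes a :: "nat \<Rightarrow> real" and c :: real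
  assumes a: "\<And>j. 0 \<le> a j" "summable a"
  defines "g \<equiv> \<lambda>z::complex. exp (- of_real c * z) * (\<Prod>j. 1 - of_real (a j) * z)"
  shows "fps_nth (fps_expansion g 0) k
     = of_real (newton_coeff (\<lambda>i. (if i = 0 then c else 0) + (\<Sum>j. a j ^ Suc i)) k)"
proof -
  let ?B = "cball (0::complex) 1"
  define P where "P m i = (if i = 0 then c else 0) + (\<Sum>j<m. a j ^ Suc i)" for m i
  define Q where "Q i = (if i = 0 then c else 0) + (\<Sum>j. a j ^ Suc i)" for i
  define f where "f j z = 1 - of_real (a j) * z" for j and z :: complex
  define h where "h m z = exp (- of_real c * z) * (\<Prod>j<m. f j z)" for m and z :: complex
  have cont: "continuous_on ?B (f j)" for j
    unfolding f_def by (intro continuous_intros)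
  have "uniformly_convergent_on ?B (\<lambda>m z. \<Sum>j<m. norm (f j z - 1))"
  proof (rule Weierstrass_m_test'[OF _ a(2)])
    fix j and z :: complex assume "z \<in> ?B"
    then show "norm (norm (f j z - 1)) \<le> a j"
      using a(1)[of j] by (simp add: f_def norm_mult mult_left_le)
  qed
  then have "uniformly_convergent_on ?B (\<lambda>m z. \<Prod>j<m. f j z)"
    by (intro uniformly_convergent_on_prod' cont) auto
  then obtain L where L: "uniform_limit ?B (\<lambda>m z. \<Prod>j<m. f j z) L sequentially"
    by (auto simp: uniformly_convergent_on_def)
  have Leq: "L z = (\<Prod>j. f j z)" if "z \<in> ?B" for z
  proof -
    have "summable (\<lambda>j. norm (f j z - 1))"
      using a by (simp add: f_def norm_mult summable_mult2)
    then have "convergent_prod (\<lambda>j. f j z)"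
      by (intro abs_convergent_prod_imp_convergent_prod) (simp add: abs_convergent_prod_conv_summable)
    then have "(\<lambda>m. \<Prod>j\<le>m. f j z) \<longlonglongrightarrow> (\<Prod>j. f j z)"
      by (rule convergent_prod_LIMSEQ)
    then have "(\<lambda>m. \<Prod>j<m. f j z) \<longlonglongrightarrow> (\<Prod>j. f j z)"
      by (subst filterlim_sequentially_Suc[symmetric]) (simp add: lessThan_Suc_atMost)
    moreover have "(\<lambda>m. \<Prod>j<m. f j z) \<longlonglongrightarrow> L z"
      by (rule tendsto_uniform_limitI[OF L that])
    ultimately show ?thesis
      by (rule LIMSEQ_unique[symmetric])
  qed
  have "uniform_limit ?B h (\<lambda>z. exp (- of_real c * z) * L z) sequentially"
    unfolding h_def
  proof (rule uniform_lim_mult[OF uniform_limit_const L])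
    show "bounded ((\<lambda>z. exp (- complex_of_real c * z)) ` ?B)"
      by (intro compact_imp_bounded compact_continuous_image continuous_intros) auto
    show "bounded (L ` ?B)"
      by (intro compact_imp_bounded compact_continuous_image uniform_limit_theorem[OF _ L])
         (auto intro!: always_eventually continuous_intros cont)
  qed
  then have "uniform_limit ?B h g sequentially"
    by (rule uniform_limit_eq_rhs[OF _ refl, THEN uniform_limit_cong'[THEN iffD1, rotated -1]])
       (auto simp: g_def Leq f_def)
  then have "uniform_limit (ball 0 1) h g sequentially"
    by (rule uniform_limit_on_subset) auto
  then have "(\<lambda>m. (deriv ^^ k) (h m) 0) \<longlonglongrightarrow> (deriv ^^ k) g 0"
    by (rule higher_deriv_complex_uniform_limit)
       (auto simp: h_def[abs_def] f_def intro!: always_eventually holomorphic_intros)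
  then have "(\<lambda>m. fps_nth (fps_expansion (h m) 0) k) \<longlonglongrightarrow> fps_nth (fps_expansion g 0) k"
    unfolding fps_expansion_def fps_nth_Abs_fps by (intro tendsto_divide tendsto_const) auto
  moreover have "fps_nth (fps_expansion (h m) 0) k = of_real (newton_coeff (P m) k)" for m
  proof -
    let ?F = "fps_exp (- of_real c) * (\<Prod>j<m. 1 - fps_const (of_real (a j)) * fps_X) :: complex fps"
    have "(\<lambda>z. h m z) has_fps_expansion ?F"
      unfolding h_def f_def by (intro fps_expansion_intros)
    then have "fps_expansion (h m) 0 = ?F"
      by (metis fps_expansion_eqI)
    moreover have "has_power_sums ?F (\<lambda>i. of_real (P m i))"
    proof -
      have "(\<lambda>i. of_real (P m i)) = (\<lambda>i. (if i = 0 then of_real c else 0) + (\<Sum>j<m. complex_of_real (a j) ^ Suc i))"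
        by (auto simp: P_def fun_eq_iff)
      moreover have "has_power_sums ?F (\<lambda>i. (if i = 0 then of_real c else 0) + (\<Sum>j<m. complex_of_real (a j) ^ Suc i))"
        by (rule has_power_sums_mult[OF has_power_sums_exp has_power_sums_prod[OF has_power_sums_linear]])
      ultimately show ?thesis
        by metis
    qed
    ultimately show ?thesis
      by (simp add: has_power_sums_imp_nth newton_coeff_of_real)
  qed
  moreover have "(\<lambda>m. newton_coeff (P m) k) \<longlonglongrightarrow> newton_coeff Q k"
    unfolding P_def Q_def
    by (intro tendsto_newton_coeff tendsto_add tendsto_const summable_LIMSEQ summable_power_of_summable a)
  ultimately have "fps_nth (fps_expansion g 0) k = of_real (newton_coeff Q k)"
    by (auto intro: LIMSEQ_unique tendsto_of_real)
  then show ?thesis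
    by (simp only: Q_def[abs_def])
qed

section \<open>From weak convergence to power sums\<close>

text \<open>The powers \<open>t^i\<close> are not bounded, but the test function \<open>1\<close> shows that the total mass
  \<open>\<Sum> y\<close> is eventually below its limit plus one.  As all \<open>y\<close> are non-negative, each of them lies
  below this bound, and \<open>t^i\<close> agrees with its truncation on all the points that matter.  At the
  origin \<open>0^i\<close> vanishes unless \<open>i = 0\<close>, which is where the weight \<open>c\<close> enters.\<close>
lemma weak_convergence_imp_power_sums:
  fixes A :: "nat \<Rightarrow> real multiset" and a :: "nat \<Rightarrow> real"
  assumes nonneg: "eventually (\<lambda>d. \<forall>y\<in>#A d. 0 \<le> y) sequentially"
    and a: "\<And>j. 0 \<le> a j" "summable a"
    and weak: "\<And>f :: real \<Rightarrow> real. continuous_on UNIV f \<Longrightarrow> bounded (range f) \<Longrightarrow>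
       (\<lambda>d. \<Sum>y\<in>#A d. y * f y) \<longlonglongrightarrow> c * f 0 + (\<Sum>j. a j * f (a j))"
  shows "(\<lambda>d. \<Sum>y\<in>#A d. y ^ Suc i) \<longlonglongrightarrow> (if i = 0 then c else 0) + (\<Sum>j. a j ^ Suc i)"
proof -
  \<comment> \<open>An upper bound for the points of \<open>A d\<close>, for large \<open>d\<close>, and for all \<open>a j\<close>.\<close>
  define B where "B = max (c + suminf a + 1) (suminf a)"
  define f where "f t = (max 0 (min t B)) ^ i" for t :: real
  have B0: "0 \<le> B"
    using suminf_nonneg[OF a(2,1)] by (simp add: B_def)
  have aB: "a j \<le> B" for j
    using sum_le_suminf[OF a(2), of "{j}"] a(1) by (auto simp: B_def)
  have "\<bar>f t\<bar> \<le> B ^ i" for t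
    using B0 by (auto simp: f_def power_abs intro!: power_mono)
  then have "bounded (range f)"
    by (auto simp: bounded_iff)
  moreover have "continuous_on UNIV f"
    unfolding f_def by (intro continuous_intros)
  ultimately have "(\<lambda>d. \<Sum>y\<in>#A d. y * f y) \<longlonglongrightarrow> c * f 0 + (\<Sum>j. a j * f (a j))"
    by (intro weak)
  also have "c * f 0 + (\<Sum>j. a j * f (a j)) = (if i = 0 then c else 0) + (\<Sum>j. a j ^ Suc i)"
    using a(1) aB B0 by (simp add: f_def max_absorb2 min_absorb1)
  finally have lim: "(\<lambda>d. \<Sum>y\<in>#A d. y * f y) \<longlonglongrightarrow> (if i = 0 then c else 0) + (\<Sum>j. a j ^ Suc i)" .
  have "(\<lambda>d. \<Sum>y\<in>#A d. y * 1) \<longlonglongrightarrow> c * 1 + (\<Sum>j. a j * 1)"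
    by (rule weak) auto
  then have "eventually (\<lambda>d. sum_mset (A d) < c + suminf a + 1) sequentially"
    by (intro order_tendstoD) auto
  with nonneg have "eventually (\<lambda>d. (\<Sum>y\<in>#A d. y * f y) = (\<Sum>y\<in>#A d. y ^ Suc i)) sequentially"
  proof eventually_elim
    case (elim d)
    have "y * f y = y ^ Suc i" if y: "y \<in># A d" for y
    proof -
      obtain A' where A': "A d = add_mset y A'"
        using y by (meson multi_member_split)
      have "0 \<le> sum_mset A'"
        using elim(1) A' sum_mset_mono[of A' "\<lambda>_. 0" "\<lambda>y. y"] by auto
      then have "y \<le> B"
        using elim(2) A' by (simp add: B_def)
      then show ?thesis
        using elim(1) y by (simp add: f_def max_absorb2 min_absorb1)
    qed
    then show ?case
      by (intro arg_cong[where f = sum_mset] image_mset_cong)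
  qed
  with lim show ?thesis
    by (simp add: filterlim_cong)
qed

section \<open>Convergence of the normalised polynomials\<close>

lemma uniform_limit_poly:
  fixes F :: "nat \<Rightarrow> complex poly"
  assumes deg: "eventually (\<lambda>d. degree (F d) \<le> l) sequentially" "degree G \<le> l"
    and coeff: "\<And>i. i \<le> l \<Longrightarrow> (\<lambda>d. coeff (F d) i) \<longlonglongrightarrow> coeff G i"
    and K: "compact K"
  shows "uniform_limit K (\<lambda>d. poly (F d)) (poly G) sequentially"
proof -
  have poly: "poly Q z = (\<Sum>i\<le>l. coeff Q i * z ^ i)" if "degree Q \<le> l" for Q :: "complex poly" and z
    unfolding poly_altdef using that
    by (intro sum.mono_neutral_left) (auto simp: coeff_eq_0)
  have monom: "uniform_limit K (\<lambda>d z. coeff (F d) i * z ^ i) (\<lambda>z. coeff G i * z ^ i) sequentially"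
    if "i \<le> l" for i
  proof -
    have "uniform_limit K (\<lambda>d z. coeff (F d) i) (\<lambda>z. coeff G i) sequentially"
      using coeff[OF that] by (auto simp: uniform_limit_iff dest: tendstoD elim: eventually_mono)
    moreover have "bounded ((\<lambda>z. z ^ i) ` K)"
      by (intro compact_imp_bounded compact_continuous_image continuous_intros K)
    ultimately show ?thesis
      by (intro uniform_lim_mult uniform_limit_const) (auto simp: image_constant_conv)
  qed
  have "uniform_limit K (\<lambda>d z. \<Sum>i\<le>m. coeff (F d) i * z ^ i) (\<lambda>z. \<Sum>i\<le>m. coeff G i * z ^ i) sequentially"
    if "m \<le> l" for m
    using that
  proof (induction m)
    case 0
    then show ?case using monom[of 0] by simp
  next
    case (Suc m)
    then show ?case
      unfolding sum.atMost_Suc by (intro uniform_limit_add monom) auto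
  qed
  from this[OF order_refl] show ?thesis
    by (rule uniform_limit_cong[THEN iffD1, rotated 2])
       (use deg in \<open>auto simp: poly elim!: eventually_mono\<close>)
qed

text \<open>Only the term \<open>k = l - i\<close> contributes, since \<open>M_n^k x^l\<close> is a multiple of \<open>x^(l-k)\<close>.\<close>
lemma coeff_fps_M_op_monom:
  assumes "i \<le> l"
  shows "coeff (fps_M_op_monom G n l) i = fps_nth G (l - i) *
     of_real (falling_factorial (real l) (l - i) * falling_factorial (n + real l) (l - i))"
proof -
  have "coeff (fps_M_op_monom G n l) i = (\<Sum>k\<le>l. if k = l - i then fps_nth G (l - i) *
     of_real (falling_factorial (real l) (l - i) * falling_factorial (n + real l) (l - i)) else 0)"
    unfolding fps_M_op_monom_def coeff_sum using assms
    by (intro sum.cong refl) (auto simp: coeff_M_op_funpow of_nat_diff)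
  then show ?thesis by simp
qed

lemma degree_fps_M_op_monom: "degree (fps_M_op_monom G n l) \<le> l"
  by (rule degree_le) (auto simp: fps_M_op_monom_def coeff_sum coeff_M_op_funpow)

text \<open>The falling factorials of \<open>d\<close> and \<open>n + d\<close> in the denominator account for the power
  \<open>d^(2 j)\<close>, those of \<open>l\<close> and \<open>n + l\<close> survive in the limit.\<close>
lemma normalized_M_op_coeff_tendsto:
  fixes p :: "nat \<Rightarrow> real poly"
  assumes n: "n > -1" and j: "j \<le> l"
    and c: "(\<lambda>d. coeff (p d) (d - j) / real d ^ (2 * j)) \<longlonglongrightarrow> q"
  shows "(\<lambda>d. coeff (smult (1 / (falling_factorial (real d) (d - l) * falling_factorial (n + real d) (d - l)))
            ((M_op n ^^ (d - l)) (p d))) (l - j))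
         \<longlonglongrightarrow> q * (falling_factorial (real l) j * falling_factorial (n + real l) j)"
proof -
  let ?f = falling_factorial
  have "(\<lambda>d. coeff (p d) (d - j) / real d ^ (2 * j) * (?f (real l) j / (?f (0 + real d) j / real d ^ j)
          * (?f (n + real l) j / (?f (n + real d) j / real d ^ j))))
        \<longlonglongrightarrow> q * (?f (real l) j / 1 * (?f (n + real l) j / 1))"
    by (intro tendsto_mult tendsto_divide tendsto_const c tendsto_falling_factorial_over_power) auto
  moreover have "eventually (\<lambda>d. coeff (p d) (d - j) / real d ^ (2 * j) * (?f (real l) j / (?f (0 + real d) j / real d ^ j)
          * (?f (n + real l) j / (?f (n + real d) j / real d ^ j))) =
       coeff (smult (1 / (?f (real d) (d - l) * ?f (n + real d) (d - l))) ((M_op n ^^ (d - l)) (p d))) (l - j)) sequentially"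
    using eventually_ge_at_top[of "max l 1"]
  proof eventually_elim
    case (elim d)
    have i: "l - j + (d - l) = d - j" "real (d - j) = real d - real j"
      using elim j by auto
    have "coeff (smult (1 / (?f (real d) (d - l) * ?f (n + real d) (d - l))) ((M_op n ^^ (d - l)) (p d))) (l - j)
       = ?f (0 + real d - real j) (d - l) / ?f (0 + real d) (d - l) *
         (?f (n + real d - real j) (d - l) / ?f (n + real d) (d - l)) * coeff (p d) (d - j)"
      by (simp add: coeff_M_op_funpow i add_diff_eq)
    also have "\<dots> = ?f (real l) j / ?f (0 + real d) j * (?f (n + real l) j / ?f (n + real d) j) * coeff (p d) (d - j)"
      using elim j n by (subst (1 2) falling_factorial_ratio) auto
    finally show ?case
      using elim by (simp add: power_mult power2_eq_square power_mult_distrib field_simps)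
  qed
  ultimately show ?thesis
    by (simp add: filterlim_cong)
qed

theorem theorem2p14:
  fixes \<sigma> \<tau> n :: real and N :: enat and \<alpha> :: "nat \<Rightarrow> real"
    and p :: "nat \<Rightarrow> real poly" and l :: nat and K :: "complex set"
  assumes "\<sigma> \<ge> 0"
    and "\<And>j. j \<in> index_upto N \<Longrightarrow> \<alpha> j \<noteq> 0"
    and "(\<lambda>j. 1 / (\<alpha> j)^2) summable_on index_upto N"
    and "n > -1"
    and "\<And>d. d \<ge> 1 \<Longrightarrow> degree (p d) = d \<and> lead_coeff (p d) = 1 \<and> nonneg_rooted (p d)"
    and "\<tau> > 0"
    and "(\<lambda>d. root_mean (p d) / real d) \<longlonglongrightarrow> \<tau>^2"
    and "converges_weakly
           (\<lambda>d. density (empirical_root_measure (dilation (1 / (real d)^2) (p d)))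
                  (\<lambda>t. ennreal (real d * t)))
           (G_measure \<sigma> N \<alpha>)"
    and "compact K"
  shows "uniform_limit K
           (\<lambda>d z. poly (map_poly of_real
              (smult (1 / (falling_factorial (real d) (d - l) *
                           falling_factorial (n + real d) (d - l)))
                 ((M_op n ^^ (d - l)) (p d)))) z)
           (\<lambda>z. poly (fps_M_op_monom (fps_expansion (g_fun \<sigma> N \<alpha>) 0) n l) z)
           sequentially"
proof -
  define a where "a = (\<lambda>j. if j \<in> index_upto N then 1 / (\<alpha> j)^2 else 0)"
  define A where "A d = image_mset (\<lambda>y. 1 / (real d)^2 * y) (proots (p d))" for d
  \<comment> \<open>The common limit: the coefficients of \<open>g\<close>.\<close>
  define q where "q = newton_coeff (\<lambda>i. (if i = 0 then \<sigma>^2 else 0) + (\<Sum>j. a j ^ Suc i))"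
  have a0: "\<And>j. 0 \<le> a j"
    by (simp add: a_def)
  have "a summable_on UNIV"
    by (rule summable_on_cong_neutral[THEN iffD1, OF _ _ _ assms(3)]) (auto simp: a_def)
  then have sa: "summable a"
    using a0 by (simp add: summable_on_UNIV_nonneg_real_iff)
  have p: "degree (p d) = d" "lead_coeff (p d) = 1" "size (proots (p d)) = degree (p d)"
      "\<And>y. y \<in># proots (p d) \<Longrightarrow> 0 \<le> y" if "d \<ge> 1" for d
    using assms(5)[OF that] by (auto simp: nonneg_rooted_def)
  have A0: "\<forall>y\<in>#A d. 0 \<le> y" if "d \<ge> 1" for d
    using p(4)[OF that] by (auto simp: A_def)
  have weak: "(\<lambda>d. \<Sum>y\<in>#A d. y * f y) \<longlonglongrightarrow> \<sigma>^2 * f 0 + (\<Sum>j. a j * f (a j))"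
    if f: "continuous_on UNIV f" "bounded (range f)" for f :: "real \<Rightarrow> real"
  proof -
    have meas: "f \<in> borel_measurable borel"
      by (rule borel_measurable_continuous_onI) fact
    obtain C where C: "\<And>t. \<bar>f t\<bar> \<le> C"
      using f(2) by (auto simp: bounded_iff)
    have "(\<lambda>d. \<integral>t. f t \<partial>density (empirical_root_measure (dilation (1 / (real d)^2) (p d))) (\<lambda>t. ennreal (real d * t)))
       \<longlonglongrightarrow> \<sigma>^2 * f 0 + (\<Sum>j. a j * f (a j))"
      using assms(8) f unfolding converges_weakly_def integral_G_measure[OF meas C a_def sa, symmetric] by blast
    moreover have "eventually (\<lambda>d. (\<integral>t. f t \<partial>density (empirical_root_measure (dilation (1 / (real d)^2) (p d))) (\<lambda>t. ennreal (real d * t)))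
        = (\<Sum>y\<in>#A d. y * f y)) sequentially"
      using eventually_ge_at_top[of 1]
    proof eventually_elim
      case (elim d)
      have dil: "proots (dilation (1 / (real d)^2) (p d)) = A d" "degree (dilation (1 / (real d)^2) (p d)) = d"
        using monic_dilation[of "1 / (real d)^2" "p d"] p[OF elim] elim by (auto simp: A_def)
      show ?case
        using integral_weighted_empirical_root_measure[of "dilation (1 / (real d)^2) (p d)" f] A0[OF elim] elim meas
        unfolding dil by auto
    qed
    ultimately show ?thesis
      by (simp add: filterlim_cong)
  qed
  have power_sums: "(\<lambda>d. \<Sum>y\<in>#A d. y ^ Suc i) \<longlonglongrightarrow> (if i = 0 then \<sigma>^2 else 0) + (\<Sum>j. a j ^ Suc i)" for i
    by (intro weak_convergence_imp_power_sums a0 sa weak eventually_sequentiallyI[of 1] A0)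
  have coeff_lim: "(\<lambda>d. coeff (p d) (d - j) / real d ^ (2 * j)) \<longlonglongrightarrow> q j" for j
  proof -
    have "(\<lambda>d. newton_coeff (\<lambda>i. \<Sum>y\<in>#A d. y ^ Suc i) j) \<longlonglongrightarrow> q j"
      unfolding q_def by (rule tendsto_newton_coeff power_sums)+
    moreover have "eventually (\<lambda>d. newton_coeff (\<lambda>i. \<Sum>y\<in>#A d. y ^ Suc i) j = coeff (p d) (d - j) / real d ^ (2 * j)) sequentially"
      using eventually_ge_at_top[of "max j 1"]
    proof eventually_elim
      case (elim d)
      have "(\<lambda>i. \<Sum>y\<in>#A d. y ^ Suc i) = (\<lambda>i. (1 / (real d)^2) ^ Suc i * (\<Sum>y\<in>#proots (p d). y ^ Suc i))"
        by (simp only: A_def image_mset.compositionality o_def power_mult_distrib sum_mset_distrib_left)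
      then have "newton_coeff (\<lambda>i. \<Sum>y\<in>#A d. y ^ Suc i) j = (1 / (real d)^2) ^ j * coeff (p d) (d - j)"
        using coeff_from_top_eq_newton[of "p d" j] p[of d] elim by (simp only: newton_coeff_scale)
      then show ?case
        by (simp add: power_divide power_mult)
    qed
    ultimately show ?thesis
      by (simp add: filterlim_cong)
  qed
  have "g_fun \<sigma> N \<alpha> = (\<lambda>z. exp (- of_real (\<sigma>^2) * z) * (\<Prod>j. 1 - of_real (a j) * z))"
    unfolding g_fun_def a_def by (intro ext arg_cong2[where f = "(*)"] refl arg_cong[where f = prodinf]) auto
  then have g: "fps_nth (fps_expansion (g_fun \<sigma> N \<alpha>) 0) j = of_real (q j)" for j
    unfolding q_def using exp_prod_coeff_eq_newton[OF a0 sa, of "\<sigma>^2" j] by simp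
  show ?thesis
  proof (rule uniform_limit_poly[OF _ degree_fps_M_op_monom _ assms(9)])
    show "eventually (\<lambda>d. degree (map_poly complex_of_real
              (smult (1 / (falling_factorial (real d) (d - l) * falling_factorial (n + real d) (d - l)))
                 ((M_op n ^^ (d - l)) (p d)))) \<le> l) sequentially"
      using eventually_ge_at_top[of "max l 1"]
      by eventually_elim (intro degree_le, auto simp: coeff_map_poly coeff_M_op_funpow p(1) intro!: coeff_eq_0)
    fix i assume "i \<le> l"
    then show "(\<lambda>d. coeff (map_poly complex_of_real
              (smult (1 / (falling_factorial (real d) (d - l) * falling_factorial (n + real d) (d - l)))
                 ((M_op n ^^ (d - l)) (p d)))) i)
       \<longlonglongrightarrow> coeff (fps_M_op_monom (fps_expansion (g_fun \<sigma> N \<alpha>) 0) n l) i"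
      using tendsto_of_real[where 'a = complex, OF normalized_M_op_coeff_tendsto[OF assms(4) diff_le_self coeff_lim, of l i]]
      by (simp add: coeff_fps_M_op_monom g coeff_map_poly)
  qed
qed

end
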